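(* Let $\alpha\in(0,1)$, let $P_k(y)$, $k\in[K]$, be the cross-conformal p-value functions built from $K$ folds of equal size $m=n/K$ and a symmetric score function $s$ as defined in the context, and let $$\hat C^{\mathrm{mod\text{-}cross}}_{n,K,\alpha}(X_{n+1})=\Big\{y\in\mathcal Y:\ \frac1K\sum_{k=1}^K P_k(y)>\alpha\Big\},$$ $$\hat C^{\mathrm{e\text{-}mod\text{-}cross}}_{n,K,\alpha}(X_{n+1})=\Big\{y\in\mathcal Y:\ \min_{\ell\in[K]}\frac1\ell\sum_{k=1}^{\ell} P_k(y)>\alpha\Big\}.$$ Then $\hat C^{\mathrm{e\text{-}mod\text{-}cross}}_{n,K,\alpha}(X_{n+1})\subseteq \hat C^{\mathrm{mod\text{-}cross}}_{n,K,\alpha}(X_{n+1})$. In addition, if the data $(X_1,Y_1),\dots,(X_{n+1},Y_{n+1})$ are exchangeable, then $$\mathbb P\big(Y_{n+1}\in \hat C^{\mathrm{e\text{-}mod\text{-}cross}}_{n,K,\alpha}(X_{n+1})\big)\ge 1-2\alpha .$$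
   Context: Write $[d]=\{1,\dots,d\}$. Data points $Z_i=(X_i,Y_i)$, $i\in[n+1]$, are random elements of $\mathcal X\times\mathcal Y$ (measurable spaces); the first $n$ are training points and $(X_{n+1},Y_{n+1})$ is the test point. For $I\subseteq[n]$ let $\mathcal D_I=(Z_i: i\in I)$. Score function: $s((x,y);\mathcal D)\in\mathbb R$ is a (measurable) function defined for $(x,y)\in\mathcal X\times\mathcal Y$ and any finite dataset $\mathcal D\in\bigcup_{d\ge1}(\mathcal X\times\mathcal Y)^d$, and it is symmetric in the dataset: $s((x,y);\mathcal D)=s((x,y);\mathcal D^\pi)$ for every $\mathcal D\in(\mathcal X\times\mathcal Y)^d$ and every permutation $\pi$ of $[d]$, where $\mathcal D^\pi$ is $\mathcal D$ with its elements permuted by $\pi$. Folds: $[n]$ is partitioned into $K\ge2$ disjoint folds $I_1,\dots,I_K$ (chosen independently of the data), each of size $m=n/K$, which is assumed to be an integer. For $i\in[n]$, $k(i)$ is the index of the fold containing $i$, and $S_i^{\mathrm{CV}}=s\big((X_i,Y_i);\mathcal D_{[n]\setminus I_{k(i)}}\big)$. Cross-conformal p-values: for $k\in[K]$ and $y\in\mathcal Y$, $$P_k(y)=\frac{1+\sum_{i\in I_k}\mathbf 1\{s((X_{n+1},y);\mathcal D_{[n]\setminus I_k})\le S_i^{\mathrm{CV}}\}}{m+1}.$$ Exchangeable means that the joint distribution is invariant under every permutation of the indices. The probability is marginal, over all data $(X_1,Y_1),\dots,(X_{n+1},Y_{n+1})$. *)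

theory Defs
  imports "HOL-Probability.Probability" "HOL-Combinatorics.Combinatorics"
begin

text \<open>
  A dataset of size \<open>d\<close> is a list of length \<open>d\<close>. Points range over \<open>space N\<close>, and nothing is
  required of the score on the empty dataset.
\<close>

definition score_symmetric :: "'z measure \<Rightarrow> ('z \<Rightarrow> 'z list \<Rightarrow> real) \<Rightarrow> bool" where
  "score_symmetric N s \<longleftrightarrow>
     (\<forall>z\<in>space N. \<forall>D p. D \<noteq> [] \<longrightarrow> set D \<subseteq> space N \<longrightarrow> p permutes {..<length D} \<longrightarrow>
        s z D = s z (permute_list p D))"

definition score_measurable :: "'z measure \<Rightarrow> ('z \<Rightarrow> 'z list \<Rightarrow> real) \<Rightarrow> bool" where
  "score_measurable N s \<longleftrightarrow>
     (\<forall>d\<ge>1. (\<lambda>(z, w). s z (map w [0..<d]))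
        \<in> borel_measurable (N \<Otimes>\<^sub>M Pi\<^sub>M {..<d} (\<lambda>_. N)))"

definition exchangeable ::
    "'w measure \<Rightarrow> 'z measure \<Rightarrow> nat set \<Rightarrow> (nat \<Rightarrow> 'w \<Rightarrow> 'z) \<Rightarrow> bool" where
  "exchangeable M N J Z \<longleftrightarrow>
     (\<forall>p. p permutes J \<longrightarrow>
        distr M (Pi\<^sub>M J (\<lambda>_. N)) (\<lambda>\<omega>. \<lambda>i\<in>J. Z (p i) \<omega>) =
        distr M (Pi\<^sub>M J (\<lambda>_. N)) (\<lambda>\<omega>. \<lambda>i\<in>J. Z i \<omega>))"

text \<open>
  The library's \<open>indep_var\<close> forces both variables to have the same value type; this is the
  same notion (in the form of \<open>indep_vars_def2\<close>) for two different value types.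
\<close>

definition indep_rvs ::
    "'w measure \<Rightarrow> 'a measure \<Rightarrow> ('w \<Rightarrow> 'a) \<Rightarrow> 'b measure \<Rightarrow> ('w \<Rightarrow> 'b) \<Rightarrow> bool" where
  "indep_rvs M A U B V \<longleftrightarrow>
     U \<in> measurable M A \<and> V \<in> measurable M B \<and>
     prob_space.indep_set M {U -` S \<inter> space M | S. S \<in> sets A} {V -` S \<inter> space M | S. S \<in> sets B}"

definition equal_folds :: "nat \<Rightarrow> nat \<Rightarrow> (nat \<Rightarrow> nat set) \<Rightarrow> bool" where
  "equal_folds n K I \<longleftrightarrow>
     disjoint_family_on I {1..K} \<and> (\<Union>k\<in>{1..K}. I k) = {1..n} \<and>
     (\<forall>k\<in>{1..K}. card (I k) = n div K)"

definition fold_index :: "nat \<Rightarrow> (nat \<Rightarrow> nat set) \<Rightarrow> nat \<Rightarrow> nat" where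
  "fold_index K I i = (THE k. k \<in> {1..K} \<and> i \<in> I k)"

definition subdata :: "(nat \<Rightarrow> 'z) \<Rightarrow> nat set \<Rightarrow> 'z list" where
  "subdata z J = map z (sorted_list_of_set J)"

definition cv_score ::
    "('z \<Rightarrow> 'z list \<Rightarrow> real) \<Rightarrow> nat \<Rightarrow> nat \<Rightarrow> (nat \<Rightarrow> nat set) \<Rightarrow> (nat \<Rightarrow> 'z) \<Rightarrow> nat \<Rightarrow> real" where
  "cv_score s n K I z i = s (z i) (subdata z ({1..n} - I (fold_index K I i)))"

text \<open>
  In the following definitions \<open>z 1, \<dots>, z n\<close> are the training points and \<open>x\<close> is the covariate of
  the test point. The fold size \<open>m = n / K\<close> is \<open>n div K\<close>, as \<open>K\<close> will divide \<open>n\<close>.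
\<close>

definition cross_pvalue ::
    "('x \<times> 'y \<Rightarrow> ('x \<times> 'y) list \<Rightarrow> real) \<Rightarrow> nat \<Rightarrow> nat \<Rightarrow> (nat \<Rightarrow> nat set) \<Rightarrow>
      (nat \<Rightarrow> 'x \<times> 'y) \<Rightarrow> 'x \<Rightarrow> nat \<Rightarrow> 'y \<Rightarrow> real" where
  "cross_pvalue s n K I z x k y =
     (1 + (\<Sum>i\<in>I k. of_bool (s (x, y) (subdata z ({1..n} - I k)) \<le> cv_score s n K I z i)))
       / (real (n div K) + 1)"

definition mod_cross_set ::
    "'y measure \<Rightarrow> ('x \<times> 'y \<Rightarrow> ('x \<times> 'y) list \<Rightarrow> real) \<Rightarrow> nat \<Rightarrow> nat \<Rightarrow> real \<Rightarrow> (nat \<Rightarrow> nat set) \<Rightarrow>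
      (nat \<Rightarrow> 'x \<times> 'y) \<Rightarrow> 'x \<Rightarrow> 'y set" where
  "mod_cross_set MY s n K \<alpha> I z x =
     {y \<in> space MY. 1 / real K * (\<Sum>k=1..K. cross_pvalue s n K I z x k y) > \<alpha>}"

definition e_mod_cross_set ::
    "'y measure \<Rightarrow> ('x \<times> 'y \<Rightarrow> ('x \<times> 'y) list \<Rightarrow> real) \<Rightarrow> nat \<Rightarrow> nat \<Rightarrow> real \<Rightarrow> (nat \<Rightarrow> nat set) \<Rightarrow>
      (nat \<Rightarrow> 'x \<times> 'y) \<Rightarrow> 'x \<Rightarrow> 'y set" where
  "e_mod_cross_set MY s n K \<alpha> I z x =
     {y \<in> space MY.
        (MIN l\<in>{1..K}. 1 / real l * (\<Sum>k=1..l. cross_pvalue s n K I z x k y)) > \<alpha>}"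

end

theory Submission imports Defs begin

text \<open>
  With \<open>e k = max 0 (2 - P k / \<alpha>)\<close>, an average of \<open>P 1, \<dots>, P l\<close> that is at most \<open>\<alpha>\<close> forces the
  average of \<open>e 1, \<dots>, e l\<close> to be at least 1. Permuting folds permutes the p-values, because the score
  is symmetric, so the \<open>e k\<close> are exchangeable, and a maximal version of Markov's inequality for
  prefix averages bounds the probability of this by the mean of \<open>e 1\<close>. That mean is at most
  \<open>2 * \<alpha>\<close>, because the rank of the test point among \<open>m + 1\<close> exchangeable points is uniform, up to ties.
  All of this is done by counting permutations of one fixed data vector. Exchangeability then turns
  the count into a probability, and independence reduces random folds to fixed ones.
\<close>

section \<open>Two finite inequalities: ranks and prefix averages\<close>

text \<open>Only the \<open>T\<close> indices with rank below \<open>2 * c\<close> contribute. Their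
  ranks add up to at least \<open>T * (T + 1) / 2\<close>, as they would without ties, because ties
  only increase a rank. So the sum is at most \<open>2 * T - T * (T + 1) / (2 * c)\<close>, a
  concave quadratic in \<open>T\<close> that never exceeds \<open>2 * c\<close>.\<close>

lemma sum_calibrated_ranks_le:
  fixes r :: "'a \<Rightarrow> real" and c :: real
  assumes "finite B" and "c > 0"
  shows "(\<Sum>j\<in>B. max 0 (2 - real (card {i\<in>B. r j \<le> r i}) / c)) \<le> 2 * c"
proof -
  define rk where "rk j = real (card {i\<in>B. r j \<le> r i})" for j
  define A where "A = {j\<in>B. rk j < 2 * c}"
  define T where "T = real (card A)"
  have A: "finite A" "A \<subseteq> B"
    using assms by (auto simp: A_def)
  have rk_ge: "(\<Sum>i\<in>A. of_bool (r j \<le> r i)) \<le> rk j" for j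
  proof -
    have "card {i\<in>A. r j \<le> r i} \<le> card {i\<in>B. r j \<le> r i}"
      using A assms by (intro card_mono) auto
    moreover have "(\<Sum>i\<in>A. of_bool (r j \<le> r i)) = real (card {i\<in>A. r j \<le> r i})"
      using A by (simp add: sum.If_cases of_bool_def Int_def)
    ultimately show ?thesis by (simp add: rk_def)
  qed
  \<comment> \<open>Each ordered pair \<open>(i, j)\<close> is comparable in at least one direction, and \<open>i = j\<close> in both.\<close>
  have "T * T + T = (\<Sum>j\<in>A. \<Sum>i\<in>A. 1 + of_bool (i = j))"
    using A by (simp add: sum.distrib T_def algebra_simps)
  also have "\<dots> \<le> (\<Sum>j\<in>A. \<Sum>i\<in>A. of_bool (r j \<le> r i) + of_bool (r i \<le> r j))"
    by (intro sum_mono) (auto simp: of_bool_def)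
  also have "\<dots> = (\<Sum>j\<in>A. \<Sum>i\<in>A. of_bool (r j \<le> r i)) + (\<Sum>j\<in>A. \<Sum>i\<in>A. of_bool (r i \<le> r j))"
    by (simp add: sum.distrib)
  also have "(\<Sum>j\<in>A. \<Sum>i\<in>A. of_bool (r i \<le> r j)) = (\<Sum>j\<in>A. \<Sum>i\<in>A. of_bool (r j \<le> r i) :: real)"
    by (rule sum.swap)
  also have "(\<Sum>j\<in>A. \<Sum>i\<in>A. of_bool (r j \<le> r i)) \<le> (\<Sum>j\<in>A. rk j)"
    by (intro sum_mono rk_ge)
  finally have ranks: "T * T + T \<le> 2 * (\<Sum>j\<in>A. rk j)"
    by simp
  have "(\<Sum>j\<in>B. max 0 (2 - rk j / c)) = (\<Sum>j\<in>A. 2 - rk j / c)"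
    using assms by (intro sum.mono_neutral_cong_right) (auto simp: A_def max_def field_simps)
  also have "\<dots> = 2 * T - (\<Sum>j\<in>A. rk j) / c"
    by (simp add: sum_subtractf T_def sum_divide_distrib)
  also have "\<dots> \<le> 2 * T - (T * T + T) / (2 * c)"
    using divide_right_mono[OF ranks, of "2 * c"] assms by simp
  also have "\<dots> \<le> 2 * c"
  proof -
    \<comment> \<open>Multiplying the goal by \<open>2 * c\<close> and collecting all terms on one
      side gives exactly this.\<close>
    have "0 \<le> (2 * c - T)\<^sup>2 + T"
      by (simp add: T_def)
    then show ?thesis
      using assms by (simp add: field_simps power2_eq_square)
  qed
  finally show ?thesis by (simp add: rk_def)
qed

text \<open>
  A finite Ville inequality. If the total average reaches 1 there is nothing to prove. Otherwise the
  full prefix cannot cross, and one conditions on the last element of the ordering.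
\<close>

lemma sum_permutations_prefix_le:
  fixes a :: "nat \<Rightarrow> real"
  assumes "\<And>k. k \<in> {1..K} \<Longrightarrow> 0 \<le> a k" and "K \<ge> 1"
  shows "real K * (\<Sum>\<sigma> | \<sigma> permutes {1..K}. of_bool (\<exists>l\<in>{1..K}. real l \<le> (\<Sum>k=1..l. a (\<sigma> k))))
    \<le> fact K * (\<Sum>k=1..K. a k)"
  using assms
proof (induction K arbitrary: a)
  case 0
  then show ?case by simp
next
  case (Suc K a)
  let ?B = "\<lambda>K a \<sigma>. of_bool (\<exists>l\<in>{1..K}. real l \<le> (\<Sum>k=1..l. a (\<sigma> k)))"
  let ?S = "\<Sum>k=1..Suc K. a k"
  show ?case
  proof (cases "real (Suc K) \<le> ?S")
    case True
    have "(\<Sum>\<sigma> | \<sigma> permutes {1..Suc K}. ?B (Suc K) a \<sigma>) \<le> (\<Sum>\<sigma> | \<sigma> permutes {1..Suc K}. 1::real)"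
      by (intro sum_mono) auto
    also have "\<dots> = fact (Suc K)"
      by (simp add: card_permutations algebra_simps)
    finally have "real (Suc K) * (\<Sum>\<sigma> | \<sigma> permutes {1..Suc K}. ?B (Suc K) a \<sigma>)
        \<le> ?S * fact (Suc K)"
      using True by (intro mult_mono) (auto intro!: sum_nonneg)
    then show ?thesis by (simp add: mult.commute)
  next
    case False
    have S_perm: "(\<Sum>k=1..Suc K. a (\<sigma> k)) = ?S" if "\<sigma> permutes {1..Suc K}" for \<sigma>
      using sum.permute[OF that, of a] by (simp add: comp_def)
    have drop_last: "?B (Suc K) a \<sigma> = (?B K a \<sigma> :: real)" if "\<sigma> permutes {1..Suc K}" for \<sigma>
    proof -
      have "\<not> real (Suc K) \<le> (\<Sum>k=1..Suc K. a (\<sigma> k))"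
        using False S_perm[OF that] by simp
      then have "(\<exists>l\<in>{1..Suc K}. real l \<le> (\<Sum>k=1..l. a (\<sigma> k)))
          \<longleftrightarrow> (\<exists>l\<in>{1..K}. real l \<le> (\<Sum>k=1..l. a (\<sigma> k)))"
        by (metis atLeastAtMost_iff le_SucE le_SucI)
      then show ?thesis by simp
    qed
    have "(\<Sum>\<sigma> | \<sigma> permutes {1..Suc K}. ?B (Suc K) a \<sigma>)
        = (\<Sum>\<sigma> | \<sigma> permutes insert (Suc K) {1..K}. ?B K a \<sigma> :: real)"
      using drop_last by (intro sum.cong) (auto simp: atLeastAtMostSuc_conv)
    also have "\<dots> = (\<Sum>b\<in>insert (Suc K) {1..K}. \<Sum>q | q permutes {1..K}.
        ?B K a (Transposition.transpose (Suc K) b \<circ> q))"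
      by (rule sum_over_permutations_insert) auto
    also have "\<dots> = (\<Sum>b=1..Suc K. \<Sum>q | q permutes {1..K}.
        ?B K (\<lambda>k. a (Transposition.transpose (Suc K) b k)) q)"
      by (simp add: atLeastAtMostSuc_conv)
    finally have split: "(\<Sum>\<sigma> | \<sigma> permutes {1..Suc K}. ?B (Suc K) a \<sigma>) = \<dots>" .
    show ?thesis
    \<comment> \<open>The induction hypothesis needs at least one position. With
      \<open>K = 0\<close> no proper prefix exists, so the left side vanishes.\<close>
    proof (cases "K = 0")
      case True
      then show ?thesis using Suc.prems split by simp
    next
      case False
      have IH: "real K * (\<Sum>q | q permutes {1..K}. ?B K (\<lambda>k. a (Transposition.transpose (Suc K) b k)) q)
          \<le> fact K * (?S - a b)" if b: "b \<in> {1..Suc K}" for b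
      proof -
        have p: "Transposition.transpose (Suc K) b permutes {1..Suc K}"
          using b by (intro permutes_swap_id) auto
        have "real K * (\<Sum>q | q permutes {1..K}. ?B K (\<lambda>k. a (Transposition.transpose (Suc K) b k)) q)
          \<le> fact K * (\<Sum>k=1..K. a (Transposition.transpose (Suc K) b k))"
          using False permutes_in_image[OF p] by (intro Suc.IH Suc.prems) auto
        \<comment> \<open>The transposition puts \<open>a b\<close> in the last position, and the
          total does not change.\<close>
        also have "(\<Sum>k=1..K. a (Transposition.transpose (Suc K) b k)) = ?S - a b"
          using S_perm[OF p] by simp
        finally show ?thesis .
      qed
      have "real K * (\<Sum>\<sigma> | \<sigma> permutes {1..Suc K}. ?B (Suc K) a \<sigma>)
          = (\<Sum>b=1..Suc K. real K *
              (\<Sum>q | q permutes {1..K}. ?B K (\<lambda>k. a (Transposition.transpose (Suc K) b k)) q))"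
        unfolding split by (rule sum_distrib_left)
      also have "\<dots> \<le> (\<Sum>b=1..Suc K. fact K * (?S - a b))"
        by (intro sum_mono IH)
      \<comment> \<open>Summing \<open>?S - a b\<close> over the \<open>K + 1\<close> choices of
        \<open>b\<close> leaves \<open>(K + 1) * ?S - ?S\<close>, so the factor \<open>K\<close>
        cancels against the left side.\<close>
      also have "\<dots> = fact K * (real K * ?S)"
        unfolding sum_distrib_left[symmetric] sum_subtractf by (simp add: algebra_simps)
      finally have "(\<Sum>\<sigma> | \<sigma> permutes {1..Suc K}. ?B (Suc K) a \<sigma>) \<le> fact K * ?S"
        using False by (simp add: mult.left_commute)
      then have "real (Suc K) * (\<Sum>\<sigma> | \<sigma> permutes {1..Suc K}. ?B (Suc K) a \<sigma>)
          \<le> real (Suc K) * (fact K * ?S)"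
        by (intro mult_left_mono) auto
      then show ?thesis by (simp add: algebra_simps)
    qed
  qed
qed

section \<open>From permutation counts to probabilities\<close>

text \<open>By exchangeability all the events \<open>E p\<close> have the same probability.
  Averaging over \<open>p\<close> makes it the expected fraction of permutations that carry the data
  into \<open>A\<close>, and this fraction is at most \<open>c\<close> at every outcome.\<close>

lemma (in prob_space) exchangeable_prob_le:
  assumes Z: "\<And>i. i \<in> J \<Longrightarrow> Z i \<in> measurable M N"
    and "finite J" and exch: "exchangeable M N J Z"
    and A: "A \<in> sets (Pi\<^sub>M J (\<lambda>_. N))"
    and le: "\<And>z. z \<in> space (Pi\<^sub>M J (\<lambda>_. N)) \<Longrightarrow>
      (\<Sum>p | p permutes J. of_bool ((\<lambda>i\<in>J. z (p i)) \<in> A)) \<le> c * fact (card J)"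
  shows "prob {\<omega>\<in>space M. (\<lambda>i\<in>J. Z i \<omega>) \<in> A} \<le> c"
proof -
  define E where "E p = {\<omega>\<in>space M. (\<lambda>i\<in>J. Z (p i) \<omega>) \<in> A}" for p
  have meas: "(\<lambda>\<omega>. \<lambda>i\<in>J. Z (p i) \<omega>) \<in> measurable M (Pi\<^sub>M J (\<lambda>_. N))" if "p permutes J" for p
    using that by (intro measurable_restrict Z) (simp add: permutes_in_image)
  have E_vimage: "E p = (\<lambda>\<omega>. \<lambda>i\<in>J. Z (p i) \<omega>) -` A \<inter> space M" for p
    by (auto simp: E_def)
  have E: "E p \<in> events" if "p permutes J" for p
    unfolding E_vimage by (rule measurable_sets[OF meas[OF that] A])
  have prob_E: "prob (E p) = prob (E id)" if p: "p permutes J" for p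
  proof -
    have "prob (E p) = measure (distr M (Pi\<^sub>M J (\<lambda>_. N)) (\<lambda>\<omega>. \<lambda>i\<in>J. Z (p i) \<omega>)) A"
      unfolding E_vimage by (rule measure_distr[OF meas[OF p] A, symmetric])
    also have "\<dots> = measure (distr M (Pi\<^sub>M J (\<lambda>_. N)) (\<lambda>\<omega>. \<lambda>i\<in>J. Z (id i) \<omega>)) A"
      using exch p by (simp add: exchangeable_def)
    also have "\<dots> = prob (E id)"
      unfolding E_vimage by (rule measure_distr[OF meas[OF permutes_id] A])
    finally show ?thesis .
  qed
  have "fact (card J) * prob (E id) = (\<Sum>p | p permutes J. prob (E id))"
    using \<open>finite J\<close> by (simp add: card_permutations)
  also have "\<dots> = (\<Sum>p | p permutes J. prob (E p))"
    by (intro sum.cong refl prob_E[symmetric]) simp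
  also have "\<dots> = (\<Sum>p | p permutes J. \<integral>\<omega>. indicator (E p) \<omega> \<partial>M)"
    using E by (intro sum.cong) auto
  also have "\<dots> = (\<integral>\<omega>. (\<Sum>p | p permutes J. indicator (E p) \<omega>) \<partial>M)"
    using E by (intro Bochner_Integration.integral_sum[symmetric]) (auto simp: emeasure_eq_measure)
  also have "\<dots> \<le> (\<integral>\<omega>. c * fact (card J) \<partial>M)"
  proof (rule integral_mono)
    show "integrable M (\<lambda>\<omega>. \<Sum>p | p permutes J. indicator (E p) \<omega> :: real)"
      using E by (intro Bochner_Integration.integrable_sum) (auto simp: emeasure_eq_measure)
    fix \<omega> assume \<omega>: "\<omega> \<in> space M"
    have "(\<Sum>p | p permutes J. indicator (E p) \<omega>)
        = (\<Sum>p | p permutes J. of_bool ((\<lambda>i\<in>J. (\<lambda>i\<in>J. Z i \<omega>) (p i)) \<in> A) :: real)"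
    proof (intro sum.cong refl)
      fix p assume "p \<in> {p. p permutes J}"
      then have "(\<lambda>i\<in>J. (\<lambda>i\<in>J. Z i \<omega>) (p i)) = (\<lambda>i\<in>J. Z (p i) \<omega>)"
        by (auto simp: permutes_in_image)
      then show "indicator (E p) \<omega> = (of_bool ((\<lambda>i\<in>J. (\<lambda>i\<in>J. Z i \<omega>) (p i)) \<in> A) :: real)"
        using \<omega> by (simp add: E_def indicator_def)
    qed
    also have "\<dots> \<le> c * fact (card J)"
      using measurable_space[OF Z \<omega>] by (intro le) (auto simp: space_PiM)
    finally show "(\<Sum>p | p permutes J. indicator (E p) \<omega>) \<le> c * fact (card J)" .
  qed auto
  also have "\<dots> = fact (card J) * c"
    by (simp add: prob_space)
  finally have "prob (E id) \<le> c"
    by simp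
  then show ?thesis by (simp add: E_def)
qed

section \<open>Symmetric scores and equal folds\<close>

text \<open>Symmetry of the score in multiset form: the sorted order in which \<open>subdata\<close>
  lists its points becomes irrelevant.\<close>

lemma score_cong_mset:
  assumes "score_symmetric N s" and "z \<in> space N" and "D \<noteq> []" and "set D \<subseteq> space N"
    and "mset D = mset D'"
  shows "s z D = s z D'"
proof -
  obtain p where "p permutes {..<length D}" "permute_list p D = D'"
    using mset_eq_permutation[of D' D] assms(5) by metis
  then show ?thesis
    using assms(1-4) unfolding score_symmetric_def by metis
qed

lemma mset_subdata: "finite L \<Longrightarrow> mset (subdata z L) = image_mset z (mset_set L)"
  by (simp add: subdata_def flip: sorted_list_of_mset_set)

lemma subdata_cong: "finite L \<Longrightarrow> (\<And>i. i \<in> L \<Longrightarrow> z i = z' i) \<Longrightarrow> subdata z L = subdata z' L"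
  by (simp add: subdata_def)

lemma equal_foldsD:
  assumes "equal_folds n K J" and "k \<in> {1..K}"
  shows "J k \<subseteq> {1..n}" and "finite (J k)" and "card (J k) = n div K"
    and "i \<in> J k \<Longrightarrow> fold_index K J i = k"
proof -
  show 1: "J k \<subseteq> {1..n}" and "card (J k) = n div K"
    using assms by (auto simp: equal_folds_def)
  show "finite (J k)"
    by (rule finite_subset[OF 1]) simp
  assume i: "i \<in> J k"
  have "\<And>k'. k' \<in> {1..K} \<and> i \<in> J k' \<Longrightarrow> k' = k"
    using assms i unfolding equal_folds_def disjoint_family_on_def by blast
  with assms(2) i show "fold_index K J i = k"
    unfolding fold_index_def by (blast intro: the_equality)
qed

text \<open>A second fold exists, has \<open>n div K > 0\<close> points and is disjoint from
  \<open>J k\<close>. This supplies the nonempty training sets on which symmetry and measurability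
  of the score are available.\<close>

lemma equal_folds_complement_nonempty:
  assumes "equal_folds n K J" and "k \<in> {1..K}" and "n \<ge> 1" and "K \<ge> 2" and "K dvd n"
  shows "{1..n} - J k \<noteq> {}"
proof -
  obtain k' where k': "k' \<in> {1..K}" "k' \<noteq> k"
    using \<open>K \<ge> 2\<close> that[of 1] that[of 2] by (cases "k = 1") auto
  have "n div K > 0"
    using assms by (auto elim!: dvdE)
  then have "J k' \<noteq> {}"
    using equal_foldsD(3)[OF assms(1) k'(1)] by auto
  moreover have "J k' \<inter> J k = {}"
    using assms(1,2) k' by (auto simp: equal_folds_def disjoint_family_on_def)
  ultimately show ?thesis
    using equal_foldsD(1)[OF assms(1) k'(1)] by blast
qed

text \<open>Folds of equal size are in bijection, and bijections from \<open>J k\<close> to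
  \<open>J (\<sigma> k)\<close> glue along the partition to a permutation of the training
  indices.\<close>

lemma fold_permutation_lift:
  assumes J: "equal_folds n K J" and \<sigma>: "\<sigma> permutes {1..K}"
  obtains \<tau> where "\<tau> permutes {1..n}" and "\<And>k. k \<in> {1..K} \<Longrightarrow> \<tau> ` J k = J (\<sigma> k)"
proof -
  have "\<exists>h. bij_betw h (J k) (J (\<sigma> k))" if "k \<in> {1..K}" for k
  proof -
    have "\<sigma> k \<in> {1..K}"
      using that permutes_in_image[OF \<sigma>] by blast
    then show ?thesis
      using that equal_foldsD[OF J] by (intro finite_same_card_bij) auto
  qed
  then obtain h where h: "\<And>k. k \<in> {1..K} \<Longrightarrow> bij_betw (h k) (J k) (J (\<sigma> k))"
    by metis
  define \<tau> where "\<tau> i = (if i \<in> {1..n} then h (fold_index K J i) i else i)" for i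
  have im: "\<tau> ` J k = J (\<sigma> k)" if k: "k \<in> {1..K}" for k
  proof -
    have "\<tau> ` J k = h k ` J k"
      using equal_foldsD[OF J k] by (intro image_cong) (auto simp: \<tau>_def)
    then show ?thesis
      using h[OF k] by (simp add: bij_betw_def)
  qed
  have cover: "(\<Union>k\<in>{1..K}. J k) = {1..n}"
    using J by (simp add: equal_folds_def)
  have "\<tau> ` {1..n} = (\<Union>k\<in>{1..K}. J (\<sigma> k))"
    unfolding cover[symmetric] image_UN using im by simp
  also have "\<dots> = (\<Union>k\<in>\<sigma> ` {1..K}. J k)"
    by simp
  also have "\<dots> = {1..n}"
    unfolding permutes_image[OF \<sigma>] by (rule cover)
  finally have surj: "\<tau> ` {1..n} = {1..n}" .
  \<comment> \<open>A surjection of a finite set onto itself is injective.\<close>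
  have "inj_on \<tau> {1..n}"
    by (rule eq_card_imp_inj_on) (simp_all only: surj finite_atLeastAtMost)
  with surj have "bij_betw \<tau> {1..n} {1..n}"
    by (simp only: bij_betw_def)
  then have "\<tau> permutes {1..n}"
    by (rule bij_imp_permutes) (auto simp: \<tau>_def)
  then show ?thesis
    using im that by blast
qed

section \<open>The p-values at the true test point and the action of permutations on them\<close>

text \<open>The p-value at the true response. The test point is stored in \<open>z\<close> at index
  \<open>n+1\<close>, so that permutations of \<open>z\<close> can also move it.\<close>

definition test_pvalue ::
    "('x \<times> 'y \<Rightarrow> ('x \<times> 'y) list \<Rightarrow> real) \<Rightarrow> nat \<Rightarrow> nat \<Rightarrow> (nat \<Rightarrow> nat set) \<Rightarrow>
      (nat \<Rightarrow> 'x \<times> 'y) \<Rightarrow> nat \<Rightarrow> real" where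
  "test_pvalue s n K J z k = cross_pvalue s n K J z (fst (z (n+1))) k (snd (z (n+1)))"

text \<open>The points of fold \<open>k\<close> and the test point are all scored against the same
  training set, the complement of the fold in \<open>{1..n}\<close>.\<close>

lemma test_pvalue_eq_sum:
  assumes J: "equal_folds n K J" "k \<in> {1..K}"
  shows "test_pvalue s n K J z k =
    (1 + (\<Sum>i\<in>J k. of_bool (s (z (n+1)) (subdata z ({1..n} - J k))
        \<le> s (z i) (subdata z ({1..n} - J k))))) / (real (n div K) + 1)"
  unfolding test_pvalue_def cross_pvalue_def cv_score_def
  using equal_foldsD(4)[OF J] by simp

text \<open>The summand 1 in the numerator counts the test point compared with itself.\<close>

lemma test_pvalue_eq_rank:
  assumes J: "equal_folds n K J" "k \<in> {1..K}"
  shows "test_pvalue s n K J z k =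
    card {i \<in> insert (n+1) (J k). s (z (n+1)) (subdata z ({1..n} - J k))
        \<le> s (z i) (subdata z ({1..n} - J k))} / (real (n div K) + 1)"
proof -
  let ?P = "\<lambda>i. s (z (n+1)) (subdata z ({1..n} - J k)) \<le> s (z i) (subdata z ({1..n} - J k))"
  have "{i \<in> insert (n+1) (J k). ?P i} = insert (n+1) {i \<in> J k. ?P i}"
    by auto
  moreover have "n + 1 \<notin> J k"
    using equal_foldsD(1)[OF J] by auto
  ultimately have "real (card {i \<in> insert (n+1) (J k). ?P i}) = 1 + (\<Sum>i\<in>J k. of_bool (?P i))"
    using equal_foldsD(2)[OF J] by (simp add: Int_def sum.If_cases of_bool_def)
  then show ?thesis
    unfolding test_pvalue_eq_sum[OF J] by simp
qed

lemma test_pvalue_cong: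
  assumes J: "equal_folds n K J" "k \<in> {1..K}" and eq: "\<And>i. i \<in> {1..n+1} \<Longrightarrow> z i = z' i"
  shows "test_pvalue s n K J z k = test_pvalue s n K J z' k"
proof -
  have "subdata z ({1..n} - J k) = subdata z' ({1..n} - J k)"
    using eq by (intro subdata_cong) auto
  moreover have "z i = z' i" if "i \<in> J k" for i
    using that equal_foldsD(1)[OF J] by (intro eq) auto
  moreover have "z (n+1) = z' (n+1)"
    by (intro eq) auto
  ultimately show ?thesis
    by (simp add: test_pvalue_eq_sum[OF J])
qed

text \<open>The swap moves no index outside \<open>insert (n+1) (J k)\<close>, so the training set
  stays the same and the \<open>m + 1\<close> scores are only relabelled. The p-value now ranks the
  point \<open>j\<close> among them.\<close>

lemma test_pvalue_transpose:
  assumes J: "equal_folds n K J" "k \<in> {1..K}" and j: "j \<in> insert (n+1) (J k)"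
  shows "test_pvalue s n K J (z \<circ> Transposition.transpose j (n+1)) k =
    card {i \<in> insert (n+1) (J k). s (z j) (subdata z ({1..n} - J k))
        \<le> s (z i) (subdata z ({1..n} - J k))} / (real (n div K) + 1)"
proof -
  let ?B = "insert (n+1) (J k)"
  define t where "t = Transposition.transpose j (n+1)"
  define r where "r i = s (z i) (subdata z ({1..n} - J k))" for i
  have t: "t permutes ?B"
    unfolding t_def using j by (intro permutes_swap_id) auto
  have "subdata (z \<circ> t) ({1..n} - J k) = subdata z ({1..n} - J k)"
    using permutes_not_in[OF t] by (intro subdata_cong) auto
  then have "test_pvalue s n K J (z \<circ> t) k
      = card {i \<in> ?B. r (t (n+1)) \<le> r (t i)} / (real (n div K) + 1)"
    unfolding test_pvalue_eq_rank[OF J] by (simp only: r_def comp_apply)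
  \<comment> \<open>The image under the involution \<open>t\<close> undoes the relabelling inside
    the counted set.\<close>
  also have "card {i \<in> ?B. r (t (n+1)) \<le> r (t i)} = card (t ` {i \<in> ?B. r (t (n+1)) \<le> r (t i)})"
    by (rule card_image[symmetric]) (rule inj_on_subset[OF permutes_inj[OF t] subset_UNIV])
  also have "t ` {i \<in> ?B. r (t (n+1)) \<le> r (t i)} = {i \<in> ?B. r j \<le> r i}"
  proof -
    have "x \<in> t ` S \<longleftrightarrow> t x \<in> S" for x S
      by (auto simp: t_def intro: rev_image_eqI)
    moreover have "t (n+1) = j" "\<And>x. t (t x) = x"
      by (simp_all add: t_def)
    ultimately show ?thesis
      by (simp only: set_eq_iff mem_Collect_eq permutes_in_image[OF t]) simp
  qed
  finally show ?thesis
    unfolding r_def t_def .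
qed

text \<open>\<open>\<tau>\<close> carries fold \<open>k\<close> to fold \<open>\<sigma> k\<close>
  and complement to complement, so both training sets agree as multisets and the score cannot tell
  them apart. The test point is fixed, since \<open>\<tau>\<close> moves training indices
  only.\<close>

lemma test_pvalue_permute_folds:
  assumes s: "score_symmetric N s" and J: "equal_folds n K J" "k \<in> {1..K}"
    and nK: "n \<ge> 1" "K \<ge> 2" "K dvd n"
    and z: "\<And>i. i \<in> {1..n+1} \<Longrightarrow> z i \<in> space N"
    and \<sigma>: "\<sigma> permutes {1..K}" and \<tau>: "\<tau> permutes {1..n}" and im: "\<tau> ` J k = J (\<sigma> k)"
  shows "test_pvalue s n K J (z \<circ> \<tau>) k = test_pvalue s n K J z (\<sigma> k)"
proof -
  have \<sigma>k: "\<sigma> k \<in> {1..K}"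
    using J(2) permutes_in_image[OF \<sigma>] by blast
  have compl: "\<tau> ` ({1..n} - J k) = {1..n} - J (\<sigma> k)"
    by (simp only: image_set_diff[OF permutes_inj[OF \<tau>]] permutes_image[OF \<tau>] im)
  define D where "D = subdata z ({1..n} - J (\<sigma> k))"
  have mset: "mset D = mset (subdata (z \<circ> \<tau>) ({1..n} - J k))"
  proof -
    have "mset_set ({1..n} - J (\<sigma> k)) = image_mset \<tau> (mset_set ({1..n} - J k))"
      unfolding compl[symmetric]
      by (rule image_mset_mset_set[symmetric]) (rule inj_on_subset[OF permutes_inj[OF \<tau>] subset_UNIV])
    then show ?thesis
      by (simp add: D_def mset_subdata multiset.map_comp)
  qed
  have D: "D \<noteq> []" "set D \<subseteq> space N"
    using equal_folds_complement_nonempty[OF J(1) \<sigma>k nK] z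
    by (auto simp: D_def subdata_def sorted_list_of_set_eq_Nil_iff)
  have score: "s (z i) (subdata (z \<circ> \<tau>) ({1..n} - J k)) = s (z i) D" if "i \<in> {1..n+1}" for i
    by (rule score_cong_mset[OF s z[OF that] D mset, symmetric])
  have "(\<Sum>i\<in>J (\<sigma> k). of_bool (s (z (n+1)) D \<le> s (z i) D))
      = (\<Sum>i\<in>J k. of_bool (s (z (n+1)) D \<le> s (z (\<tau> i)) D) :: real)"
    unfolding im[symmetric]
    by (subst sum.reindex) (simp_all only: comp_def inj_on_subset[OF permutes_inj[OF \<tau>] subset_UNIV])
  also have "\<dots> = (\<Sum>i\<in>J k. of_bool
      (s ((z \<circ> \<tau>) (n+1)) (subdata (z \<circ> \<tau>) ({1..n} - J k))
        \<le> s ((z \<circ> \<tau>) i) (subdata (z \<circ> \<tau>) ({1..n} - J k))))"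
  proof (intro sum.cong refl)
    fix i assume "i \<in> J k"
    then have "\<tau> i \<in> {1..n}"
      using im equal_foldsD(1)[OF J(1) \<sigma>k] by blast
    moreover have "\<tau> (n+1) = n+1"
      by (rule permutes_not_in[OF \<tau>]) simp
    ultimately show "of_bool (s (z (n+1)) D \<le> s (z (\<tau> i)) D) = (of_bool
        (s ((z \<circ> \<tau>) (n+1)) (subdata (z \<circ> \<tau>) ({1..n} - J k))
          \<le> s ((z \<circ> \<tau>) i) (subdata (z \<circ> \<tau>) ({1..n} - J k))) :: real)"
      using score[of "\<tau> i"] score[of "n+1"] by simp
  qed
  finally show ?thesis
    by (simp only: test_pvalue_eq_sum[OF J] test_pvalue_eq_sum[OF J(1) \<sigma>k] D_def)
qed

section \<open>Averages over all permutations of a fixed data vector\<close>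

text \<open>Composing \<open>p\<close> on the right with the swap of \<open>j\<close> and
  \<open>n+1\<close> only reindexes the sum. Hence \<open>m + 1\<close> copies of it, one for each
  \<open>j\<close> in the fold or at the test index, can be bounded together by the rank inequality
  with \<open>c = (m + 1) * \<alpha>\<close>.\<close>

lemma sum_permutations_calibrated_le:
  assumes J: "equal_folds n K J" "k \<in> {1..K}" and "\<alpha> > 0"
  shows "(\<Sum>p | p permutes {1..n+1}. max 0 (2 - test_pvalue s n K J (z \<circ> p) k / \<alpha>))
    \<le> 2 * \<alpha> * fact (n+1)"
proof -
  let ?B = "insert (n+1) (J k)"
  let ?t = "\<lambda>j. Transposition.transpose j (n+1)"
  let ?e = "\<lambda>w. max 0 (2 - test_pvalue s n K J w k / \<alpha>)"
  let ?m = "real (n div K) + 1"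
  have card_B: "real (card ?B) = ?m" "finite ?B"
    using equal_foldsD[OF J] by (auto simp: card_insert_if)
  \<comment> \<open>Exchanging the test point with points of its own fold leaves the training set unchanged.\<close>
  have inner: "(\<Sum>j\<in>?B. ?e (w \<circ> ?t j)) \<le> 2 * (?m * \<alpha>)" for w
  proof -
    let ?r = "\<lambda>i. s (w i) (subdata w ({1..n} - J k))"
    have "(\<Sum>j\<in>?B. ?e (w \<circ> ?t j))
        = (\<Sum>j\<in>?B. max 0 (2 - real (card {i\<in>?B. ?r j \<le> ?r i}) / (?m * \<alpha>)))"
      by (intro sum.cong refl) (simp only: test_pvalue_transpose[OF J] divide_divide_eq_left)
    also have "\<dots> \<le> 2 * (?m * \<alpha>)"
      using card_B \<open>\<alpha> > 0\<close> by (intro sum_calibrated_ranks_le mult_pos_pos) auto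
    finally show ?thesis .
  qed
  have "?m * (\<Sum>p | p permutes {1..n+1}. ?e (z \<circ> p))
      = (\<Sum>j\<in>?B. \<Sum>p | p permutes {1..n+1}. ?e (z \<circ> p))"
    by (simp only: sum_constant card_B)
  also have "\<dots> = (\<Sum>j\<in>?B. \<Sum>p | p permutes {1..n+1}. ?e (z \<circ> (p \<circ> ?t j)))"
  proof (rule sum.cong[OF refl])
    fix j assume "j \<in> ?B"
    then have "?t j permutes {1..n+1}"
      using equal_foldsD(1)[OF J] by (intro permutes_swap_id) auto
    then show "(\<Sum>p | p permutes {1..n+1}. ?e (z \<circ> p))
        = (\<Sum>p | p permutes {1..n+1}. ?e (z \<circ> (p \<circ> ?t j)))"
      by (rule sum_permutations_compose_right)
  qed
  also have "\<dots> = (\<Sum>p | p permutes {1..n+1}. \<Sum>j\<in>?B. ?e ((z \<circ> p) \<circ> ?t j))"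
    by (subst sum.swap) (simp only: o_assoc)
  also have "\<dots> \<le> (\<Sum>p | p permutes {1..n+1}. 2 * (?m * \<alpha>))"
    by (intro sum_mono inner)
  also have "\<dots> = ?m * (2 * \<alpha> * fact (n+1))"
    by (simp add: card_permutations algebra_simps)
  finally show ?thesis
    by (simp add: add_pos_nonneg)
qed

text \<open>Reindexing by a lift of \<sigma> replaces the natural order of the folds by the order
  \<sigma> without changing the count \<open>?S\<close>. So \<open>?S\<close> can be averaged over
  all \<sigma>, which is what the prefix inequality needs. What remains is the sum of the
  \<open>e (z \<circ> p) k\<close>, controlled fold by fold.\<close>

lemma sum_permutations_prefix_mean_le:
  assumes s: "score_symmetric N s" and J: "equal_folds n K J"
    and nK: "n \<ge> 1" "K \<ge> 2" "K dvd n"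
    and z: "\<And>i. i \<in> {1..n+1} \<Longrightarrow> z i \<in> space N" and "\<alpha> > 0"
  shows "(\<Sum>p | p permutes {1..n+1}.
      of_bool (\<exists>l\<in>{1..K}. 1 / real l * (\<Sum>k=1..l. test_pvalue s n K J (z \<circ> p) k) \<le> \<alpha>))
    \<le> 2 * \<alpha> * fact (n+1)" (is "?S \<le> _")
proof -
  let ?Q = "{p. p permutes {1..n+1}}"
  let ?P = "\<lambda>w k. test_pvalue s n K J w k"
  define e where "e w k = max 0 (2 - ?P w k / \<alpha>)" for w k
  define bad where "bad w \<longleftrightarrow> (\<exists>l\<in>{1..K}. 1 / real l * (\<Sum>k=1..l. ?P w k) \<le> \<alpha>)" for w
  define cross where "cross w \<sigma> \<longleftrightarrow> (\<exists>l\<in>{1..K}. real l \<le> (\<Sum>k=1..l. e w (\<sigma> k)))" for w \<sigma>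
  have z_perm: "(z \<circ> p) i \<in> space N" if "p permutes {1..n+1}" "i \<in> {1..n+1}" for p i
    using z permutes_in_image[OF that(1)] that(2) by auto
  have bad_cross: "?S \<le> (\<Sum>p\<in>?Q. of_bool (cross (z \<circ> p) \<sigma>))" if \<sigma>: "\<sigma> permutes {1..K}" for \<sigma>
  proof -
    obtain \<tau> where \<tau>: "\<tau> permutes {1..n}" "\<And>k. k \<in> {1..K} \<Longrightarrow> \<tau> ` J k = J (\<sigma> k)"
      using fold_permutation_lift[OF J \<sigma>] by blast
    have \<tau>': "\<tau> permutes {1..n+1}"
      by (rule permutes_subset[OF \<tau>(1)]) auto
    have "?S = (\<Sum>p\<in>?Q. of_bool (bad (z \<circ> (p \<circ> \<tau>))))"
      unfolding bad_def by (rule sum_permutations_compose_right[OF \<tau>'])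
    also have "\<dots> \<le> (\<Sum>p\<in>?Q. of_bool (cross (z \<circ> p) \<sigma>))"
    proof (intro sum_mono)
      fix p assume "p \<in> ?Q"
      then have p: "p permutes {1..n+1}" by simp
      have P: "?P (z \<circ> (p \<circ> \<tau>)) k = ?P (z \<circ> p) (\<sigma> k)" if "k \<in> {1..K}" for k
        unfolding o_assoc
        by (rule test_pvalue_permute_folds[OF s J that nK z_perm[OF p] \<sigma> \<tau>(1) \<tau>(2)[OF that]])
      have "cross (z \<circ> p) \<sigma>" if bad: "bad (z \<circ> (p \<circ> \<tau>))"
      proof -
        obtain l where l: "l \<in> {1..K}" "1 / real l * (\<Sum>k=1..l. ?P (z \<circ> (p \<circ> \<tau>)) k) \<le> \<alpha>"
          using bad unfolding bad_def by blast
        have "(\<Sum>k=1..l. ?P (z \<circ> (p \<circ> \<tau>)) k) = (\<Sum>k=1..l. ?P (z \<circ> p) (\<sigma> k))"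
          using l(1) by (intro sum.cong refl P) auto
        then have "(\<Sum>k=1..l. ?P (z \<circ> p) (\<sigma> k)) \<le> \<alpha> * real l"
          using l by (simp add: field_simps)
        then have "(\<Sum>k=1..l. ?P (z \<circ> p) (\<sigma> k)) / \<alpha> \<le> real l"
          using \<open>\<alpha> > 0\<close> by (simp add: field_simps)
        \<comment> \<open>The constant 2 turns a mean of \<open>?P / \<alpha>\<close> of at most 1
          into a mean of at least 1; truncation at 0 can then only raise it.\<close>
        then have "real l \<le> (\<Sum>k=1..l. 2 - ?P (z \<circ> p) (\<sigma> k) / \<alpha>)"
          by (simp add: sum_subtractf sum_divide_distrib)
        also have "\<dots> \<le> (\<Sum>k=1..l. e (z \<circ> p) (\<sigma> k))"
          by (intro sum_mono) (simp add: e_def)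
        finally show ?thesis
          using l(1) by (auto simp: cross_def)
      qed
      then show "of_bool (bad (z \<circ> (p \<circ> \<tau>))) \<le> (of_bool (cross (z \<circ> p) \<sigma>) :: real)"
        by simp
    qed
    finally show ?thesis .
  qed
  have "fact K * ?S = (\<Sum>\<sigma> | \<sigma> permutes {1..K}. ?S)"
    by (simp add: card_permutations)
  also have "\<dots> \<le> (\<Sum>\<sigma> | \<sigma> permutes {1..K}. \<Sum>p\<in>?Q. of_bool (cross (z \<circ> p) \<sigma>))"
    by (intro sum_mono bad_cross) simp
  also have "\<dots> = (\<Sum>p\<in>?Q. \<Sum>\<sigma> | \<sigma> permutes {1..K}. of_bool (cross (z \<circ> p) \<sigma>))"
    by (rule sum.swap)
  finally have "real K * (fact K * ?S)
      \<le> (\<Sum>p\<in>?Q. real K * (\<Sum>\<sigma> | \<sigma> permutes {1..K}. of_bool (cross (z \<circ> p) \<sigma>)))"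
    unfolding sum_distrib_left[of "real K", symmetric] by (intro mult_left_mono) auto
  \<comment> \<open>For each \<open>p\<close> the values \<open>e (z \<circ> p) k\<close> are fixed
    nonnegative numbers, and only their order varies with \<sigma>.\<close>
  also have "\<dots> \<le> (\<Sum>p\<in>?Q. fact K * (\<Sum>k=1..K. e (z \<circ> p) k))"
    unfolding cross_def using nK
    by (intro sum_mono sum_permutations_prefix_le) (auto simp: e_def)
  also have "\<dots> = fact K * (\<Sum>k=1..K. \<Sum>p\<in>?Q. e (z \<circ> p) k)"
    unfolding sum_distrib_left[symmetric] by (subst sum.swap) simp
  also have "\<dots> \<le> fact K * (\<Sum>k=1..K. 2 * \<alpha> * fact (n+1))"
    unfolding e_def using J \<open>\<alpha> > 0\<close>
    by (intro mult_left_mono sum_mono sum_permutations_calibrated_le) auto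
  also have "\<dots> = real K * (fact K * (2 * \<alpha> * fact (n+1)))"
    by simp
  finally show ?thesis
    using nK by simp
qed

section \<open>Measurability and the bound for fixed folds\<close>

text \<open>Allows a fold assignment to be replaced by its restriction to
  \<open>{1..K}\<close>.\<close>

lemma test_pvalue_cong_folds:
  assumes "equal_folds n K J" and "equal_folds n K J'" and "k \<in> {1..K}" and "J k = J' k"
  shows "test_pvalue s n K J z k = test_pvalue s n K J' z k"
  using assms by (simp add: test_pvalue_eq_sum)

text \<open>Measurability of the score is stated for tuples indexed by \<open>{..<d}\<close>.
  Listing \<open>L\<close> in increasing order turns the selected coordinates of \<open>z\<close>
  into such a tuple by a measurable map.\<close>

lemma borel_measurable_score_subdata:
  fixes N :: "'a measure"
  assumes s: "score_measurable N s" and L: "finite L" "L \<noteq> {}" "L \<subseteq> A" and "i \<in> A"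
  shows "(\<lambda>z. s (z i) (subdata z L)) \<in> borel_measurable (Pi\<^sub>M A (\<lambda>_. N))"
proof -
  define l where "l = sorted_list_of_set L"
  define d where "d = length l"
  have "d \<ge> 1"
    using L by (simp add: d_def l_def Suc_le_eq card_gt_0_iff)
  then have s': "(\<lambda>(z, w). s z (map w [0..<d])) \<in> borel_measurable (N \<Otimes>\<^sub>M Pi\<^sub>M {..<d} (\<lambda>_. N))"
    using s by (simp add: score_measurable_def)
  have "l ! a \<in> A" if "a < d" for a
    using that L nth_mem[of a l] by (auto simp: d_def l_def)
  then have "(\<lambda>z. (z i, \<lambda>a\<in>{..<d}. z (l ! a)))
      \<in> measurable (Pi\<^sub>M A (\<lambda>_. N)) (N \<Otimes>\<^sub>M Pi\<^sub>M {..<d} (\<lambda>_. N))"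
    using \<open>i \<in> A\<close> by (intro measurable_Pair measurable_restrict measurable_component_singleton) auto
  from measurable_compose[OF this s']
  have "(\<lambda>z. s (z i) (map (\<lambda>a\<in>{..<d}. z (l ! a)) [0..<d])) \<in> borel_measurable (Pi\<^sub>M A (\<lambda>_. N))"
    by simp
  moreover have "subdata z L = map (\<lambda>a\<in>{..<d}. z (l ! a)) [0..<d]" for z :: "_ \<Rightarrow> 'a"
    unfolding subdata_def l_def[symmetric] by (rule nth_equalityI) (auto simp: d_def)
  ultimately show ?thesis by (simp only:)
qed

lemma borel_measurable_test_pvalue:
  assumes s: "score_measurable N s" and J: "equal_folds n K J" "k \<in> {1..K}"
    and nK: "n \<ge> 1" "K \<ge> 2" "K dvd n"
  shows "(\<lambda>z. test_pvalue s n K J z k) \<in> borel_measurable (Pi\<^sub>M {1..n+1} (\<lambda>_. N))"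
proof -
  have score: "(\<lambda>z. s (z i) (subdata z ({1..n} - J k)))
      \<in> borel_measurable (Pi\<^sub>M {1..n+1} (\<lambda>_. N))" if "i \<in> {1..n+1}" for i
    using that equal_folds_complement_nonempty[OF J nK]
    by (intro borel_measurable_score_subdata[OF s]) auto
  have of_bool_le: "(\<lambda>z. of_bool (f z \<le> g z) :: real) \<in> borel_measurable (Pi\<^sub>M {1..n+1} (\<lambda>_. N))"
    if "f \<in> borel_measurable (Pi\<^sub>M {1..n+1} (\<lambda>_. N))"
      "g \<in> borel_measurable (Pi\<^sub>M {1..n+1} (\<lambda>_. N))" for f g :: "_ \<Rightarrow> real"
  proof -
    have [measurable]: "Measurable.pred (Pi\<^sub>M {1..n+1} (\<lambda>_. N)) (\<lambda>z. f z \<le> g z)"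
      unfolding pred_def by (rule borel_measurable_le[OF that])
    show ?thesis
      by measurable
  qed
  have "(\<lambda>z. of_bool (s (z (n+1)) (subdata z ({1..n} - J k))
        \<le> s (z i) (subdata z ({1..n} - J k))) :: real)
      \<in> borel_measurable (Pi\<^sub>M {1..n+1} (\<lambda>_. N))" if "i \<in> J k" for i
    using that equal_foldsD(1)[OF J] by (intro of_bool_le score) auto
  then show ?thesis
    unfolding test_pvalue_eq_sum[OF J]
    by (intro borel_measurable_divide borel_measurable_add borel_measurable_sum) auto
qed

text \<open>The permutation count holds at every data vector, so exchangeability makes it a bound on
  the probability that some prefix mean is at most \<alpha>.\<close>

lemma (in prob_space) exchangeable_prefix_mean_le:
  assumes Z: "\<And>i. i \<in> {1..n+1} \<Longrightarrow> Z i \<in> measurable M N"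
    and exch: "exchangeable M N {1..n+1} Z"
    and s: "score_measurable N s" "score_symmetric N s"
    and J: "equal_folds n K J" and nK: "n \<ge> 1" "K \<ge> 2" "K dvd n" and "\<alpha> > 0"
  defines "A \<equiv> {z \<in> space (Pi\<^sub>M {1..n+1} (\<lambda>_. N)).
    \<exists>l\<in>{1..K}. 1 / real l * (\<Sum>k=1..l. test_pvalue s n K J z k) \<le> \<alpha>}"
  shows "A \<in> sets (Pi\<^sub>M {1..n+1} (\<lambda>_. N))"
    and "prob {\<omega>\<in>space M. (\<lambda>i\<in>{1..n+1}. Z i \<omega>) \<in> A} \<le> 2 * \<alpha>"
proof -
  let ?PN = "Pi\<^sub>M {1..n+1} (\<lambda>_. N)"
  have "{z \<in> space ?PN. 1 / real l * (\<Sum>k=1..l. test_pvalue s n K J z k) \<le> \<alpha>} \<in> sets ?PN"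
    if "l \<in> {1..K}" for l
  proof -
    have "(\<lambda>z. 1 / real l * (\<Sum>k=1..l. test_pvalue s n K J z k)) \<in> borel_measurable ?PN"
      using that
      by (intro borel_measurable_times borel_measurable_const borel_measurable_sum
          borel_measurable_test_pvalue[OF s(1) J _ nK]) auto
    then show ?thesis
      by (intro borel_measurable_le) auto
  qed
  then have "(\<Union>l\<in>{1..K}. {z \<in> space ?PN. 1 / real l * (\<Sum>k=1..l. test_pvalue s n K J z k) \<le> \<alpha>})
      \<in> sets ?PN"
    by (intro sets.finite_UN) auto
  also have "(\<Union>l\<in>{1..K}. {z \<in> space ?PN. 1 / real l * (\<Sum>k=1..l. test_pvalue s n K J z k) \<le> \<alpha>}) = A"
    by (auto simp: A_def)
  finally show A: "A \<in> sets ?PN" .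
  show "prob {\<omega>\<in>space M. (\<lambda>i\<in>{1..n+1}. Z i \<omega>) \<in> A} \<le> 2 * \<alpha>"
  proof (rule exchangeable_prob_le[OF Z _ exch A])
    fix z assume z: "z \<in> space ?PN"
    have z_in: "z i \<in> space N" if "i \<in> {1..n+1}" for i
      using z that by (auto simp: space_PiM)
    have "(\<Sum>p | p permutes {1..n+1}. of_bool ((\<lambda>i\<in>{1..n+1}. z (p i)) \<in> A))
        \<le> (\<Sum>p | p permutes {1..n+1}. of_bool
          (\<exists>l\<in>{1..K}. 1 / real l * (\<Sum>k=1..l. test_pvalue s n K J (z \<circ> p) k) \<le> \<alpha>) :: real)"
    proof (intro sum_mono)
      fix p
      have "test_pvalue s n K J (\<lambda>i\<in>{1..n+1}. z (p i)) k = test_pvalue s n K J (z \<circ> p) k"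
        if "k \<in> {1..K}" for k
        by (rule test_pvalue_cong[OF J that]) simp
      then have "(\<Sum>k=1..l. test_pvalue s n K J (\<lambda>i\<in>{1..n+1}. z (p i)) k)
          = (\<Sum>k=1..l. test_pvalue s n K J (z \<circ> p) k)" if "l \<in> {1..K}" for l
        using that by (intro sum.cong) auto
      then show "of_bool ((\<lambda>i\<in>{1..n+1}. z (p i)) \<in> A) \<le> (of_bool
          (\<exists>l\<in>{1..K}. 1 / real l * (\<Sum>k=1..l. test_pvalue s n K J (z \<circ> p) k) \<le> \<alpha>) :: real)"
        unfolding A_def by simp
    qed
    also have "\<dots> \<le> 2 * \<alpha> * fact (n+1)"
      by (rule sum_permutations_prefix_mean_le[OF s(2) J nK z_in \<open>\<alpha> > 0\<close>])
    finally show "(\<Sum>p | p permutes {1..n+1}. of_bool ((\<lambda>i\<in>{1..n+1}. z (p i)) \<in> A))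
        \<le> 2 * \<alpha> * fact (card {1..n+1})"
      by simp
  qed auto
qed

section \<open>Random folds and coverage\<close>

text \<open>\<open>E\<close> splits over the finitely many values \<open>J\<close> of
  \<open>U\<close>. Independence factors each piece into at most \<open>prob (P J) * c\<close>, and
  the disjoint events \<open>P J\<close> have total probability at most 1.\<close>

lemma (in prob_space) prob_mixture_le:
  assumes indep: "indep_rvs M A U B V" and "finite F"
    and F: "\<And>J. J \<in> F \<Longrightarrow> {J} \<in> sets A" and R: "\<And>J. J \<in> F \<Longrightarrow> R J \<in> sets B"
    and le: "\<And>J. J \<in> F \<Longrightarrow> prob (V -` R J \<inter> space M) \<le> c" and "c \<ge> 0"
  defines "E \<equiv> {\<omega>\<in>space M. U \<omega> \<in> F \<and> V \<omega> \<in> R (U \<omega>)}"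
  shows "E \<in> events" and "prob E \<le> c"
proof -
  define P where "P J = U -` {J} \<inter> space M" for J
  define Q where "Q J = V -` R J \<inter> space M" for J
  have U: "U \<in> measurable M A" and V: "V \<in> measurable M B"
    and ind: "indep_set {U -` S \<inter> space M | S. S \<in> sets A} {V -` S \<inter> space M | S. S \<in> sets B}"
    using indep by (auto simp: indep_rvs_def)
  have P: "P J \<in> events" and Q: "Q J \<in> events" if "J \<in> F" for J
    unfolding P_def Q_def using that U V F R by (auto intro!: measurable_sets)
  have prod: "prob (P J \<inter> Q J) = prob (P J) * prob (Q J)" if "J \<in> F" for J
    by (rule indep_setD[OF ind]) (use that F R in \<open>auto simp: P_def Q_def\<close>)
  have E_eq: "E = (\<Union>J\<in>F. P J \<inter> Q J)"
    by (auto simp: E_def P_def Q_def)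
  show "E \<in> events"
    unfolding E_eq using \<open>finite F\<close> P Q by (intro sets.finite_UN sets.Int)
  have "prob E \<le> (\<Sum>J\<in>F. prob (P J \<inter> Q J))"
    unfolding E_eq using \<open>finite F\<close> P Q by (intro finite_measure_subadditive_finite) auto
  also have "\<dots> \<le> (\<Sum>J\<in>F. prob (P J) * c)"
    using le by (intro sum_mono) (simp add: prod mult_left_mono flip: Q_def)
  also have "\<dots> = prob (\<Union>J\<in>F. P J) * c"
  proof -
    have "disjoint_family_on P F"
      by (auto simp: disjoint_family_on_def P_def)
    then have "prob (\<Union>J\<in>F. P J) = (\<Sum>J\<in>F. prob (P J))"
      using \<open>finite F\<close> P by (intro finite_measure_finite_Union) auto
    then show ?thesis
      by (simp add: sum_distrib_right)
  qed
  also have "\<dots> \<le> c"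
    using \<open>c \<ge> 0\<close> by (simp add: mult_left_le_one_le)
  finally show "prob E \<le> c" .
qed

theorem theorem4p4:
  fixes M :: "'w measure" and MX :: "'x measure" and MY :: "'y measure"
    and X :: "nat \<Rightarrow> 'w \<Rightarrow> 'x" and Y :: "nat \<Rightarrow> 'w \<Rightarrow> 'y"
    and s :: "'x \<times> 'y \<Rightarrow> ('x \<times> 'y) list \<Rightarrow> real"
    and n K :: nat and I :: "'w \<Rightarrow> nat \<Rightarrow> nat set" and \<alpha> :: real
  defines "Z \<equiv> \<lambda>i \<omega>. (X i \<omega>, Y i \<omega>)"
  assumes "prob_space M"
    and "\<And>i. i \<in> {1..n+1} \<Longrightarrow> X i \<in> measurable M MX"
    and "\<And>i. i \<in> {1..n+1} \<Longrightarrow> Y i \<in> measurable M MY"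
    and "score_measurable (MX \<Otimes>\<^sub>M MY) s"
    and "score_symmetric (MX \<Otimes>\<^sub>M MY) s"
    and "n \<ge> 1" and "K \<ge> 2" and "K dvd n"
    and "\<And>\<omega>. \<omega> \<in> space M \<Longrightarrow> equal_folds n K (I \<omega>)"
    and "indep_rvs M
           (Pi\<^sub>M {1..K} (\<lambda>_. count_space (Pow {1..n}))) (\<lambda>\<omega>. \<lambda>k\<in>{1..K}. I \<omega> k)
           (Pi\<^sub>M {1..n+1} (\<lambda>_. MX \<Otimes>\<^sub>M MY)) (\<lambda>\<omega>. \<lambda>i\<in>{1..n+1}. Z i \<omega>)"
    and "0 < \<alpha>" and "\<alpha> < 1"
  shows "(\<forall>\<omega>\<in>space M.
            e_mod_cross_set MY s n K \<alpha> (I \<omega>) (\<lambda>i. Z i \<omega>) (X (n+1) \<omega>)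
              \<subseteq> mod_cross_set MY s n K \<alpha> (I \<omega>) (\<lambda>i. Z i \<omega>) (X (n+1) \<omega>)) \<and>
         (exchangeable M (MX \<Otimes>\<^sub>M MY) {1..n+1} Z \<longrightarrow>
            measure M {\<omega> \<in> space M. Y (n+1) \<omega> \<in>
              e_mod_cross_set MY s n K \<alpha> (I \<omega>) (\<lambda>i. Z i \<omega>) (X (n+1) \<omega>)} \<ge> 1 - 2 * \<alpha>)"
proof (intro conjI ballI impI)
  fix \<omega>
  show "e_mod_cross_set MY s n K \<alpha> (I \<omega>) (\<lambda>i. Z i \<omega>) (X (n+1) \<omega>)
      \<subseteq> mod_cross_set MY s n K \<alpha> (I \<omega>) (\<lambda>i. Z i \<omega>) (X (n+1) \<omega>)"
    \<comment> \<open>The prefix \<open>l = K\<close> of the minimum is the mean over all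
      folds.\<close>
    unfolding e_mod_cross_set_def mod_cross_set_def using \<open>K \<ge> 2\<close> by (subst Min_gr_iff) auto
next
  interpret prob_space M by fact
  note nK = \<open>n \<ge> 1\<close> \<open>K \<ge> 2\<close> \<open>K dvd n\<close>
  note folds = assms(10)
  assume exch: "exchangeable M (MX \<Otimes>\<^sub>M MY) {1..n+1} Z"
  have Z: "Z i \<in> measurable M (MX \<Otimes>\<^sub>M MY)" if "i \<in> {1..n+1}" for i
    unfolding Z_def using that assms(3,4) by (intro measurable_Pair)
  let ?PN = "Pi\<^sub>M {1..n+1} (\<lambda>_. MX \<Otimes>\<^sub>M MY)"
  let ?U = "\<lambda>\<omega>. \<lambda>k\<in>{1..K}. I \<omega> k" and ?V = "\<lambda>\<omega>. \<lambda>i\<in>{1..n+1}. Z i \<omega>"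
  let ?G = "{\<omega> \<in> space M. Y (n+1) \<omega> \<in>
      e_mod_cross_set MY s n K \<alpha> (I \<omega>) (\<lambda>i. Z i \<omega>) (X (n+1) \<omega>)}"
  define bad where "bad J z \<longleftrightarrow>
      (\<exists>l\<in>{1..K}. 1 / real l * (\<Sum>k=1..l. test_pvalue s n K J z k) \<le> \<alpha>)" for J z
  define R where "R J = {z \<in> space ?PN. bad J z}" for J
  \<comment> \<open>Fold assignments are taken as extensional functions, so that there are only
    finitely many.\<close>
  define F where "F = {J \<in> {1..K} \<rightarrow>\<^sub>E Pow {1..n}. equal_folds n K J}"
  define E where "E = {\<omega>\<in>space M. ?U \<omega> \<in> F \<and> ?V \<omega> \<in> R (?U \<omega>)}"
  have "finite F"
    unfolding F_def by (rule finite_subset[of _ "{1..K} \<rightarrow>\<^sub>E Pow {1..n}"]) (auto intro!: finite_PiE)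
  have singletons: "{J} \<in> sets (Pi\<^sub>M {1..K} (\<lambda>_. count_space (Pow {1..n})))" if "J \<in> F" for J
  proof -
    have "(\<Pi>\<^sub>E k\<in>{1..K}. {J k}) \<in> sets (Pi\<^sub>M {1..K} (\<lambda>_. count_space (Pow {1..n})))"
      using that by (intro sets_PiM_I_finite) (auto simp: F_def)
    also have "(\<Pi>\<^sub>E k\<in>{1..K}. {J k}) = {J}"
      using that by (intro PiE_singleton) (simp add: F_def PiE_iff)
    finally show ?thesis .
  qed
  have R: "R J \<in> sets ?PN" "prob (?V -` R J \<inter> space M) \<le> 2 * \<alpha>" if "J \<in> F" for J
  proof -
    have J: "equal_folds n K J"
      using that by (simp add: F_def)
    note * = exchangeable_prefix_mean_le[OF Z exch assms(5,6) J nK \<open>0 < \<alpha>\<close>,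
        folded bad_def, folded R_def]
    show "R J \<in> sets ?PN"
      by (rule *(1))
    have "?V -` R J \<inter> space M = {\<omega>\<in>space M. ?V \<omega> \<in> R J}"
      by auto
    then show "prob (?V -` R J \<inter> space M) \<le> 2 * \<alpha>"
      using *(2) by simp
  qed
  have E: "E \<in> events" "prob E \<le> 2 * \<alpha>"
    unfolding E_def using \<open>0 < \<alpha>\<close>
    by (intro prob_mixture_le[OF assms(11) \<open>finite F\<close> singletons R]; simp)+
  \<comment> \<open>\<open>E\<close> is miscoverage expressed through the restricted folds and data.
    The restrictions do not affect the p-values, so its complement is the coverage event.\<close>
  have "?G = space M - E"
  proof -
    have "\<omega> \<in> ?G \<longleftrightarrow> \<omega> \<notin> E" if \<omega>: "\<omega> \<in> space M" for \<omega>
    proof -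
      have U: "equal_folds n K (?U \<omega>)"
        using folds[OF \<omega>] by (simp add: equal_folds_def disjoint_family_on_def)
      have "?U \<omega> \<in> F"
        using U equal_foldsD(1)[OF folds[OF \<omega>]] by (auto simp: F_def)
      moreover have "?V \<omega> \<in> space ?PN"
        using measurable_space[OF Z \<omega>] by (auto simp: space_PiM)
      moreover have "bad (?U \<omega>) (?V \<omega>) \<longleftrightarrow> bad (I \<omega>) (\<lambda>i. Z i \<omega>)"
      proof -
        have "test_pvalue s n K (?U \<omega>) (?V \<omega>) k = test_pvalue s n K (I \<omega>) (\<lambda>i. Z i \<omega>) k"
          if k: "k \<in> {1..K}" for k
        proof -
          have "test_pvalue s n K (?U \<omega>) (?V \<omega>) k = test_pvalue s n K (I \<omega>) (?V \<omega>) k"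
            using k by (intro test_pvalue_cong_folds[OF U folds[OF \<omega>]]) auto
          also have "\<dots> = test_pvalue s n K (I \<omega>) (\<lambda>i. Z i \<omega>) k"
            by (rule test_pvalue_cong[OF folds[OF \<omega>] k]) simp
          finally show ?thesis .
        qed
        then have "(\<Sum>k=1..l. test_pvalue s n K (?U \<omega>) (?V \<omega>) k)
            = (\<Sum>k=1..l. test_pvalue s n K (I \<omega>) (\<lambda>i. Z i \<omega>) k)" if "l \<in> {1..K}" for l
          using that by (intro sum.cong) auto
        then show ?thesis
          unfolding bad_def by simp
      qed
      ultimately have "\<omega> \<in> E \<longleftrightarrow> bad (I \<omega>) (\<lambda>i. Z i \<omega>)"
        using \<omega> by (simp add: E_def R_def)
      \<comment> \<open>The prediction set contains only points of \<open>space MY\<close>, so this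
        is part of coverage.\<close>
      moreover have "Y (n+1) \<omega> \<in> space MY"
        by (rule measurable_space[OF assms(4) \<omega>]) simp
      then have "\<omega> \<in> ?G \<longleftrightarrow> \<not> bad (I \<omega>) (\<lambda>i. Z i \<omega>)"
        using \<omega> \<open>K \<ge> 2\<close> unfolding e_mod_cross_set_def bad_def test_pvalue_def
        by (simp add: Z_def Min_gr_iff not_le)
      ultimately show ?thesis by blast
    qed
    moreover have "?G \<subseteq> space M" "E \<subseteq> space M"
      by (auto simp: E_def)
    ultimately show ?thesis by blast
  qed
  then show "prob ?G \<ge> 1 - 2 * \<alpha>"
    using E by (simp add: prob_compl)
qed

end
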